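(* Let $\Pi X.\, s\ [\exists\vec{x}.\,\varphi]$ and $\Pi Y.\, t\ [\exists\vec{y}.\,\psi]$ be satisfiable pattern-general existentially constrained terms. Then $\Pi X.\, s\ [\exists\vec{x}.\,\varphi] \sim \Pi Y.\, t\ [\exists\vec{y}.\,\psi]$ if and only if there exists a renaming $\rho$ such that $s\rho = t$, $\rho(X)=Y$, and $\vDash_{\mathcal{M}} (\exists\vec{x}.\,\varphi)\rho \Leftrightarrow (\exists\vec{y}.\,\psi)$.
   Context: Fix a many-sorted signature whose sorts are partitioned into theory sorts and term sorts and whose function symbols are partitioned into theory symbols (all argument and result sorts are theory sorts) and term symbols; terms are built from these symbols and sorted variables. A fixed model $\mathcal{M}$ interprets theory sorts and theory symbols; the sort Bool is interpreted as $\{\mathsf{true},\mathsf{false}\}$, the usual connectives and equality are available as theory symbols, and every element of the interpretation of every theory sort is a constant symbol of the signature, called a value; $\mathcal{V}al$ is the set of values. A logical constraint is a Bool-sorted term built from theory symbols and variables. A valuation $\rho$ maps theory-sorted variables to elements of the interpretations of their sorts; $\vDash_{\mathcal{M},\rho}\varphi$ means $\varphi$ evaluates to true under $\rho$. Substitutions are sort-preserving; $\sigma|_U$ agrees with $\sigma$ on $U$ and is the identity elsewhere; $\sigma$ is $X$-valued if $\sigma(X)\subseteq\mathcal{V}al$. A renaming is a bijective substitution from variables to variables. $\mathcal{V}ar(\cdot)$ denotes the set of variables occurring in an expression. An existential constraint $\exists\vec{x}.\,\varphi$ is a pair of a sequence of variables $\vec{x}$ and a logical constraint $\varphi$ with $\{\vec{x}\}\subseteq\mathcal{V}ar(\varphi)$;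 its free variables are $\mathcal{FV}ar(\exists\vec{x}.\varphi)=\mathcal{V}ar(\varphi)\setminus\{\vec{x}\}$. $\vDash_{\mathcal{M},\rho}\exists\vec{x}.\varphi$ iff there are values $\vec{v}$ with $\vDash_{\mathcal{M},\rho}\varphi\{\vec{x}\mapsto\vec{v}\}$; the constraint is satisfiable if this holds for some $\rho$. For a substitution $\sigma$, $(\exists\vec{x}.\varphi)\sigma := \exists\vec{x}.(\varphi\,\sigma|_{\mathcal{FV}ar(\exists\vec{x}.\varphi)})$, and $\sigma\vDash_{\mathcal{M}}\exists\vec{x}.\varphi$ means $\sigma(\mathcal{FV}ar(\exists\vec{x}.\varphi))\subseteq\mathcal{V}al$ and $\vDash_{\mathcal{M},\rho}(\exists\vec{x}.\varphi)\sigma$ for all $\rho$. $\vDash_{\mathcal{M}} A\Leftrightarrow B$ means that for every valuation $\rho$, $\vDash_{\mathcal{M},\rho}A$ iff $\vDash_{\mathcal{M},\rho}B$. An existentially constrained term $\Pi X.\, s\ [\exists\vec{x}.\,\varphi]$ is a triple of a set $X$ of variables, a term $s$ and an existential constraint with $\mathcal{FV}ar(\exists\vec{x}.\varphi)\subseteq X\subseteq\mathcal{V}ar(s)$ and $\{\vec{x}\}\cap\mathcal{V}ar(s)=\emptyset$; it is satisfiable if its constraint is. It is pattern-general if every variable of $X$ occurs at most once in $s$ and no value occurs in $s$. $\Pi X.\, s\ [\exists\vec{x}.\varphi]$ is subsumed by $\Pi Y.\, t\ [\exists\vec{y}.\psi]$ if for every $X$-valued substitution $\sigma$ with $\sigma\vDash_{\mathcal{M}}\exists\vec{x}.\varphi$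 there is a $Y$-valued substitution $\gamma$ with $\gamma\vDash_{\mathcal{M}}\exists\vec{y}.\psi$ and $s\sigma=t\gamma$; the two are equivalent ($\sim$) if each is subsumed by the other.
   Formalization: Variables in X and Y are taken to have theory sorts, each theory sort has infinitely many variables, and (∃x.φ)ρ is read as capture-avoiding (bound variables renamed apart when ρ would introduce them); with capture, or with term-sorted variables in X, the literal claim fails. *)

theory Defs
  imports Main
begin

datatype (syms: 'f, vars: 'v) trm = Var 'v | Fun 'f "('f, 'v) trm list"

primrec vars_list :: "('f, 'v) trm \<Rightarrow> 'v list" where
  "vars_list (Var x) = [x]"
| "vars_list (Fun f ts) = concat (map vars_list ts)"

type_synonym ('f, 'v) subst = "'v \<Rightarrow> ('f, 'v) trm"

primrec subst_apply :: "('f, 'v) trm \<Rightarrow> ('f, 'v) subst \<Rightarrow> ('f, 'v) trm" (infixl "\<cdot>" 67) where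
  "Var x \<cdot> \<sigma> = \<sigma> x"
| "Fun f ts \<cdot> \<sigma> = Fun f (map (\<lambda>t. t \<cdot> \<sigma>) ts)"

definition subst_restrict :: "('f, 'v) subst \<Rightarrow> 'v set \<Rightarrow> ('f, 'v) subst" (infixl "|s" 68) where
  "\<sigma> |s U = (\<lambda>x. if x \<in> U then \<sigma> x else Var x)"

text \<open>
  A signature together with its model. The types \<open>'s\<close>, \<open>'f\<close>, \<open>'v\<close> are the sorts, the function
  symbols and the variables; term sorts and term symbols are the complements of
  \<open>theory_sorts\<close> and \<open>theory_syms\<close>. Since every element of the interpretation of a theory
  sort is itself a constant symbol, the model lives on \<open>'f\<close>.
\<close>

record ('s, 'f, 'v) lc_model =
  theory_sorts :: "'s set"
  theory_syms :: "'f set"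
  arg_sorts :: "'f \<Rightarrow> 's list"
  res_sort :: "'f \<Rightarrow> 's"
  var_sort :: "'v \<Rightarrow> 's"
  carrier :: "'s \<Rightarrow> 'f set"
  interp :: "'f \<Rightarrow> 'f list \<Rightarrow> 'f"
  bool_sort :: 's
  true_val :: 'f
  false_val :: 'f
  not_sym :: 'f
  and_sym :: 'f
  or_sym :: 'f
  imp_sym :: 'f
  iff_sym :: 'f
  eq_sym :: "'s \<Rightarrow> 'f"

definition truth :: "('s, 'f, 'v) lc_model \<Rightarrow> bool \<Rightarrow> 'f" where
  "truth M b = (if b then true_val M else false_val M)"

locale lc_structure =
  fixes M :: "('s, 'f, 'v) lc_model"
  assumes theory_sym_sorts:
      "\<And>f. f \<in> theory_syms M \<Longrightarrow> set (arg_sorts M f) \<subseteq> theory_sorts M \<and> res_sort M f \<in> theory_sorts M"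
    and interp_closed:
      "\<And>f as. f \<in> theory_syms M \<Longrightarrow> list_all2 (\<lambda>a \<tau>. a \<in> carrier M \<tau>) as (arg_sorts M f)
        \<Longrightarrow> interp M f as \<in> carrier M (res_sort M f)"
    and value_symbol:
      "\<And>\<tau> c. \<tau> \<in> theory_sorts M \<Longrightarrow> c \<in> carrier M \<tau>
        \<Longrightarrow> c \<in> theory_syms M \<and> arg_sorts M c = [] \<and> res_sort M c = \<tau> \<and> interp M c [] = c"
    and bool_theory: "bool_sort M \<in> theory_sorts M"
    and bool_carrier: "carrier M (bool_sort M) = {true_val M, false_val M}"
    and true_neq_false: "true_val M \<noteq> false_val M"
    and not_symbol:
      "not_sym M \<in> theory_syms M" "arg_sorts M (not_sym M) = [bool_sort M]"
      "res_sort M (not_sym M) = bool_sort M"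
      "\<And>a. interp M (not_sym M) [truth M a] = truth M (\<not> a)"
    and connective_symbols:
      "\<And>f. f \<in> {and_sym M, or_sym M, imp_sym M, iff_sym M} \<Longrightarrow>
        f \<in> theory_syms M \<and> arg_sorts M f = [bool_sort M, bool_sort M] \<and> res_sort M f = bool_sort M"
      "\<And>a b. interp M (and_sym M) [truth M a, truth M b] = truth M (a \<and> b)"
      "\<And>a b. interp M (or_sym M) [truth M a, truth M b] = truth M (a \<or> b)"
      "\<And>a b. interp M (imp_sym M) [truth M a, truth M b] = truth M (a \<longrightarrow> b)"
      "\<And>a b. interp M (iff_sym M) [truth M a, truth M b] = truth M (a \<longleftrightarrow> b)"
    and eq_symbol:
      "\<And>\<tau>. \<tau> \<in> theory_sorts M \<Longrightarrow>
        eq_sym M \<tau> \<in> theory_syms M \<and> arg_sorts M (eq_sym M \<tau>) = [\<tau>, \<tau>] \<and> res_sort M (eq_sym M \<tau>) = bool_sort M"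
      "\<And>\<tau> a b. \<tau> \<in> theory_sorts M \<Longrightarrow> a \<in> carrier M \<tau> \<Longrightarrow> b \<in> carrier M \<tau>
        \<Longrightarrow> interp M (eq_sym M \<tau>) [a, b] = truth M (a = b)"
    and infinite_vars: "\<And>\<tau>. \<tau> \<in> theory_sorts M \<Longrightarrow> infinite {x. var_sort M x = \<tau>}"

inductive has_sort :: "('s, 'f, 'v) lc_model \<Rightarrow> ('f, 'v) trm \<Rightarrow> 's \<Rightarrow> bool" for M where
  Var: "has_sort M (Var x) (var_sort M x)"
| Fun: "list_all2 (has_sort M) ts (arg_sorts M f) \<Longrightarrow> has_sort M (Fun f ts) (res_sort M f)"

definition Val :: "('s, 'f, 'v) lc_model \<Rightarrow> 'f set" where
  "Val M = (\<Union>\<tau>\<in>theory_sorts M. carrier M \<tau>)"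

definition val_terms :: "('s, 'f, 'v) lc_model \<Rightarrow> ('f, 'v) trm set" where
  "val_terms M = (\<lambda>v. Fun v []) ` Val M"

definition substitution :: "('s, 'f, 'v) lc_model \<Rightarrow> ('f, 'v) subst \<Rightarrow> bool" where
  "substitution M \<sigma> \<longleftrightarrow> (\<forall>x. has_sort M (\<sigma> x) (var_sort M x))"

definition valued_on :: "('s, 'f, 'v) lc_model \<Rightarrow> 'v set \<Rightarrow> ('f, 'v) subst \<Rightarrow> bool" where
  "valued_on M X \<sigma> \<longleftrightarrow> \<sigma> ` X \<subseteq> val_terms M"

definition renaming :: "('s, 'f, 'v) lc_model \<Rightarrow> ('v \<Rightarrow> 'v) \<Rightarrow> bool" where
  "renaming M \<rho> \<longleftrightarrow> bij \<rho> \<and> (\<forall>x. var_sort M (\<rho> x) = var_sort M x)"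

definition valuation :: "('s, 'f, 'v) lc_model \<Rightarrow> ('v \<Rightarrow> 'f) \<Rightarrow> bool" where
  "valuation M \<rho> \<longleftrightarrow> (\<forall>x. var_sort M x \<in> theory_sorts M \<longrightarrow> \<rho> x \<in> carrier M (var_sort M x))"

primrec interp_term :: "('s, 'f, 'v) lc_model \<Rightarrow> ('v \<Rightarrow> 'f) \<Rightarrow> ('f, 'v) trm \<Rightarrow> 'f" where
  "interp_term M \<rho> (Var x) = \<rho> x"
| "interp_term M \<rho> (Fun f ts) = interp M f (map (interp_term M \<rho>) ts)"

definition logical_constraint :: "('s, 'f, 'v) lc_model \<Rightarrow> ('f, 'v) trm \<Rightarrow> bool" where
  "logical_constraint M \<phi> \<longleftrightarrow> has_sort M \<phi> (bool_sort M) \<and> syms \<phi> \<subseteq> theory_syms M"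

definition holds :: "('s, 'f, 'v) lc_model \<Rightarrow> ('v \<Rightarrow> 'f) \<Rightarrow> ('f, 'v) trm \<Rightarrow> bool" where
  "holds M \<rho> \<phi> \<longleftrightarrow> interp_term M \<rho> \<phi> = true_val M"

type_synonym ('f, 'v) ex_constr = "'v list \<times> ('f, 'v) trm"

definition ex_constraint :: "('s, 'f, 'v) lc_model \<Rightarrow> ('f, 'v) ex_constr \<Rightarrow> bool" where
  "ex_constraint M = (\<lambda>(xs, \<phi>). logical_constraint M \<phi> \<and> set xs \<subseteq> vars \<phi>)"

definition FVar :: "('f, 'v) ex_constr \<Rightarrow> 'v set" where
  "FVar = (\<lambda>(xs, \<phi>). vars \<phi> - set xs)"

definition list_subst :: "'v list \<Rightarrow> 'f list \<Rightarrow> ('f, 'v) subst" where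
  "list_subst xs vs = (\<lambda>x. case map_of (zip xs vs) x of None \<Rightarrow> Var x | Some v \<Rightarrow> Fun v [])"

definition ex_holds :: "('s, 'f, 'v) lc_model \<Rightarrow> ('v \<Rightarrow> 'f) \<Rightarrow> ('f, 'v) ex_constr \<Rightarrow> bool" where
  "ex_holds M \<rho> = (\<lambda>(xs, \<phi>).
     \<exists>vs. list_all2 (\<lambda>v x. v \<in> carrier M (var_sort M x)) vs xs \<and> holds M \<rho> (\<phi> \<cdot> list_subst xs vs))"

definition ex_satisfiable :: "('s, 'f, 'v) lc_model \<Rightarrow> ('f, 'v) ex_constr \<Rightarrow> bool" where
  "ex_satisfiable M C \<longleftrightarrow> (\<exists>\<rho>. valuation M \<rho> \<and> ex_holds M \<rho> C)"

definition ex_equiv :: "('s, 'f, 'v) lc_model \<Rightarrow> ('f, 'v) ex_constr \<Rightarrow> ('f, 'v) ex_constr \<Rightarrow> bool" where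
  "ex_equiv M C D \<longleftrightarrow> (\<forall>\<rho>. valuation M \<rho> \<longrightarrow> ex_holds M \<rho> C = ex_holds M \<rho> D)"

definition fresh_renaming :: "('s, 'f, 'v) lc_model \<Rightarrow> 'v set \<Rightarrow> 'v set \<Rightarrow> ('v \<Rightarrow> 'v) \<Rightarrow> bool" where
  "fresh_renaming M A B \<pi> \<longleftrightarrow> (\<forall>x. var_sort M (\<pi> x) = var_sort M x) \<and> inj_on \<pi> B \<and> \<pi> ` B \<inter> A = {}"

text \<open>
  Application of a substitution to an existential constraint is
  \<open>(\<exists>xs. \<phi>)\<sigma> = \<exists>xs. (\<phi> (\<sigma> |s FVar (\<exists>xs. \<phi>)))\<close>, read with the usual convention that bound variables
  are renamed apart beforehand if a variable introduced by \<open>\<sigma>\<close> would be captured.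
\<close>

definition ex_subst ::
    "('s, 'f, 'v) lc_model \<Rightarrow> ('f, 'v) ex_constr \<Rightarrow> ('f, 'v) subst \<Rightarrow> ('f, 'v) ex_constr" where
  "ex_subst M = (\<lambda>(xs, \<phi>) \<sigma>.
     let F = FVar (xs, \<phi>); R = (\<Union>z\<in>F. vars (\<sigma> z)) in
     if set xs \<inter> R = {} then (xs, \<phi> \<cdot> (\<sigma> |s F))
     else let \<pi> = (SOME \<pi>. fresh_renaming M (F \<union> R) (set xs) \<pi>) in
       (map \<pi> xs, \<phi> \<cdot> (\<lambda>z. if z \<in> F then \<sigma> z else Var (\<pi> z))))"

lemma ex_subst_no_capture:
  assumes "\<And>z. z \<in> FVar (xs, \<phi>) \<Longrightarrow> set xs \<inter> vars (\<sigma> z) = {}"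
  shows "ex_subst M (xs, \<phi>) \<sigma> = (xs, \<phi> \<cdot> (\<sigma> |s FVar (xs, \<phi>)))"
proof -
  have "set xs \<inter> (\<Union>z\<in>FVar (xs, \<phi>). vars (\<sigma> z)) = {}" using assms by blast
  then show ?thesis by (simp add: ex_subst_def Let_def)
qed

lemma (in lc_structure) fresh_renaming_exists:
  assumes "finite A" "finite B" "\<And>x. x \<in> B \<Longrightarrow> var_sort M x \<in> theory_sorts M"
  shows "\<exists>\<pi>. fresh_renaming M A B \<pi>"
  using assms(2,3)
proof (induction B rule: finite_induct)
  case empty
  show ?case by (rule exI[of _ id]) (simp add: fresh_renaming_def)
next
  case (insert b B)
  then obtain \<pi> where \<pi>: "fresh_renaming M A B \<pi>" by blast
  have "infinite ({x. var_sort M x = var_sort M b} - (A \<union> \<pi> ` B))"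
    using infinite_vars[of "var_sort M b"] insert assms(1) by (simp add: Diff_infinite_finite)
  then obtain v where v: "var_sort M v = var_sort M b" "v \<notin> A" "v \<notin> \<pi> ` B"
    using infinite_imp_nonempty by blast
  have "fresh_renaming M A (insert b B) (\<pi>(b := v))"
    using \<pi> v insert.hyps(2) unfolding fresh_renaming_def inj_on_def by auto
  then show ?case by blast
qed

definition subst_models :: "('s, 'f, 'v) lc_model \<Rightarrow> ('f, 'v) subst \<Rightarrow> ('f, 'v) ex_constr \<Rightarrow> bool" where
  "subst_models M \<sigma> C \<longleftrightarrow>
     valued_on M (FVar C) \<sigma> \<and> (\<forall>\<rho>. valuation M \<rho> \<longrightarrow> ex_holds M \<rho> (ex_subst M C \<sigma>))"

type_synonym ('f, 'v) ex_cterm = "'v set \<times> ('f, 'v) trm \<times> ('f, 'v) ex_constr"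

text \<open>
  The variables in \<open>X\<close> are to be instantiated by values, hence they have theory sorts.
\<close>

definition ex_constrained_term :: "('s, 'f, 'v) lc_model \<Rightarrow> ('f, 'v) ex_cterm \<Rightarrow> bool" where
  "ex_constrained_term M = (\<lambda>(X, s, C).
     var_sort M ` X \<subseteq> theory_sorts M \<and> (\<exists>\<tau>. has_sort M s \<tau>) \<and> ex_constraint M C \<and>
     FVar C \<subseteq> X \<and> X \<subseteq> vars s \<and> set (fst C) \<inter> vars s = {})"

definition satisfiable :: "('s, 'f, 'v) lc_model \<Rightarrow> ('f, 'v) ex_cterm \<Rightarrow> bool" where
  "satisfiable M = (\<lambda>(X, s, C). ex_satisfiable M C)"

definition pattern_general :: "('s, 'f, 'v) lc_model \<Rightarrow> ('f, 'v) ex_cterm \<Rightarrow> bool" where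
  "pattern_general M = (\<lambda>(X, s, C).
     (\<forall>x\<in>X. count_list (vars_list s) x \<le> 1) \<and> syms s \<inter> Val M = {})"

definition subsumed_by :: "('s, 'f, 'v) lc_model \<Rightarrow> ('f, 'v) ex_cterm \<Rightarrow> ('f, 'v) ex_cterm \<Rightarrow> bool" where
  "subsumed_by M = (\<lambda>(X, s, C) (Y, t, D).
     \<forall>\<sigma>. substitution M \<sigma> \<and> valued_on M X \<sigma> \<and> subst_models M \<sigma> C \<longrightarrow>
       (\<exists>\<gamma>. substitution M \<gamma> \<and> valued_on M Y \<gamma> \<and> subst_models M \<gamma> D \<and> s \<cdot> \<sigma> = t \<cdot> \<gamma>))"

definition equivalent :: "('s, 'f, 'v) lc_model \<Rightarrow> ('f, 'v) ex_cterm \<Rightarrow> ('f, 'v) ex_cterm \<Rightarrow> bool" where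
  "equivalent M P Q \<longleftrightarrow> subsumed_by M P Q \<and> subsumed_by M Q P"

end

theory Submission
  imports Defs
begin

text \<open>
  Instantiate \<open>X\<close> by satisfying values and keep all other variables: \<open>s\<sigma>\<^sub>0 = t\<gamma>\<close>, and in the same
  way \<open>t\<gamma>\<^sub>0 = s\<sigma>\<close>. As \<open>s\<close> and \<open>t\<close> contain no values, these two equations force \<open>s\<close> and \<open>t\<close> to have
  the same shape, and they relate the variable occurrences of \<open>s\<close> to those of \<open>t\<close>, matching \<open>X\<close>
  with \<open>Y\<close>. Outside \<open>X\<close> and \<open>Y\<close> the relation is read off \<open>\<sigma>\<close> and \<open>\<gamma>\<close>, hence one-to-one; on \<open>X\<close>
  and \<open>Y\<close> it is one-to-one by linearity. The resulting finite sort-preserving bijection extends to a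
  renaming, through which subsumption becomes implication between the constraints.
\<close>

section \<open>Terms, substitutions and interpretation\<close>

lemma set_vars_list [simp]: "set (vars_list t) = vars t"
  by (induction t) auto

lemma vars_list_map_trm: "vars_list (map_trm f g t) = map g (vars_list t)"
proof (induction t)
  case (Fun h ts)
  then show ?case by (simp add: map_concat comp_def cong: map_cong)
qed simp

lemma finite_vars [simp]: "finite (vars t)"
  by (metis List.finite_set set_vars_list)

lemma subst_apply_cong: "(\<And>x. x \<in> vars t \<Longrightarrow> \<sigma> x = \<tau> x) \<Longrightarrow> t \<cdot> \<sigma> = t \<cdot> \<tau>"
  by (induction t) auto

lemma subst_apply_eq_iff: "t \<cdot> \<sigma> = t \<cdot> \<tau> \<longleftrightarrow> (\<forall>x\<in>vars t. \<sigma> x = \<tau> x)"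
  by (induction t) auto

lemma subst_renaming_apply: "t \<cdot> (Var \<circ> \<rho>) \<cdot> \<sigma> = t \<cdot> (\<sigma> \<circ> \<rho>)"
  by (induction t) auto

text \<open>Turns renamings into the map of the term datatype, so that \<open>trm.map_comp\<close>
  and \<open>trm.map_cong0\<close> apply to them.\<close>

lemma subst_Var_comp: "t \<cdot> (Var \<circ> \<rho>) = map_trm id \<rho> t"
  by (induction t) auto

lemma interp_term_cong:
  "(\<And>x. x \<in> vars t \<Longrightarrow> \<rho> x = \<rho>' x) \<Longrightarrow> interp_term M \<rho> t = interp_term M \<rho>' t"
proof (induction t)
  case (Fun f ts)
  then have "map (interp_term M \<rho>) ts = map (interp_term M \<rho>') ts"
    by auto
  then show ?case by (metis interp_term.simps(2))
qed simp

lemma interp_term_subst: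
  "interp_term M \<rho> (t \<cdot> \<sigma>) = interp_term M (\<lambda>x. interp_term M \<rho> (\<sigma> x)) t"
proof (induction t)
  case (Fun f ts)
  then show ?case by (simp add: comp_def cong: map_cong)
qed simp

lemma has_sort_unique: "has_sort M t \<tau> \<Longrightarrow> has_sort M t \<tau>' \<Longrightarrow> \<tau> = \<tau>'"
  by (auto elim!: has_sort.cases)

section \<open>Renamings that extend finite injections\<close>

lemma extend_to_renaming:
  assumes fin: "finite A" and f: "inj_on f A" "\<And>x. x \<in> A \<Longrightarrow> var_sort M (f x) = var_sort M x"
  obtains \<rho> where "renaming M \<rho>" "\<And>x. x \<in> A \<Longrightarrow> \<rho> x = f x"
proof -
  define B where "B = f ` A"
  have finB: "finite B" using fin by (simp add: B_def)
  let ?S = "\<lambda>\<tau> S. {x \<in> S. var_sort M x = \<tau>}"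
  have "\<exists>h. bij_betw h (?S \<tau> (B - A)) (?S \<tau> (A - B))" for \<tau>
  proof (rule finite_same_card_bij)
    have "f ` ?S \<tau> A = ?S \<tau> B" using f(2) by (auto simp: B_def)
    then have "card (?S \<tau> A) = card (?S \<tau> B)"
      using card_image[of f "?S \<tau> A"] inj_on_subset[OF f(1), of "?S \<tau> A"] by auto
    \<comment> \<open>The part inside \<open>A \<inter> B\<close> is common to both sets; cancelling
      it leaves differences of equal size.\<close>
    moreover have "?S \<tau> A = ?S \<tau> (A - B) \<union> ?S \<tau> (A \<inter> B)" "?S \<tau> B = ?S \<tau> (B - A) \<union> ?S \<tau> (A \<inter> B)"
      by auto
    moreover have "card (?S \<tau> (A - B) \<union> ?S \<tau> (A \<inter> B)) = card (?S \<tau> (A - B)) + card (?S \<tau> (A \<inter> B))"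
      "card (?S \<tau> (B - A) \<union> ?S \<tau> (A \<inter> B)) = card (?S \<tau> (B - A)) + card (?S \<tau> (A \<inter> B))"
      by (intro card_Un_disjoint; use fin finB in auto)+
    ultimately show "card (?S \<tau> (B - A)) = card (?S \<tau> (A - B))" by simp
  qed (use fin finB in auto)
  then obtain h where h: "\<And>\<tau>. bij_betw (h \<tau>) (?S \<tau> (B - A)) (?S \<tau> (A - B))"
    by metis
  \<comment> \<open>The bijections chosen for the single sorts are glued into one map.\<close>
  define g where "g x = h (var_sort M x) x" for x
  have g: "g x \<in> A - B" "var_sort M (g x) = var_sort M x" if "x \<in> B - A" for x
    using bij_betwE[OF h[of "var_sort M x"]] that by (auto simp: g_def)
  have g_inj: "inj_on g (B - A)"
  proof (rule inj_onI)
    fix x y assume xy: "x \<in> B - A" "y \<in> B - A" "g x = g y"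
    then have "var_sort M x = var_sort M y" using g(2) by metis
    then show "x = y"
      using xy bij_betw_imp_inj_on[OF h[of "var_sort M x"]] by (auto simp: g_def inj_on_def)
  qed
  have g_surj: "g ` (B - A) = A - B"
  proof (intro equalityI subsetI)
    fix y assume y: "y \<in> A - B"
    then have "y \<in> h (var_sort M y) ` ?S (var_sort M y) (B - A)"
      using bij_betw_imp_surj_on[OF h[of "var_sort M y"]] by auto
    then show "y \<in> g ` (B - A)" unfolding g_def by force
  qed (use g in auto)
  define \<rho> where "\<rho> x = (if x \<in> A then f x else if x \<in> B then g x else x)" for x
  have "bij_betw \<rho> A B" using f(1) by (auto simp: \<rho>_def B_def bij_betw_def inj_on_def)
  moreover have "bij_betw \<rho> (B - A) (A - B)"
    using g_inj g_surj by (auto simp: \<rho>_def bij_betw_def inj_on_def image_def)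
  ultimately have "bij_betw \<rho> (A \<union> (B - A)) (B \<union> (A - B))"
    by (rule bij_betw_combine) auto
  moreover have "bij_betw \<rho> (- (A \<union> B)) (- (A \<union> B))"
    by (auto simp: \<rho>_def bij_betw_def inj_on_def image_def)
  ultimately have "bij_betw \<rho> (A \<union> (B - A) \<union> - (A \<union> B)) (B \<union> (A - B) \<union> - (A \<union> B))"
    by (rule bij_betw_combine) auto
  moreover have "A \<union> (B - A) \<union> - (A \<union> B) = UNIV" "B \<union> (A - B) \<union> - (A \<union> B) = UNIV" by auto
  ultimately have "bij \<rho>" by simp
  then have "renaming M \<rho>" using f(2) g(2) by (auto simp: renaming_def \<rho>_def)
  then show thesis by (rule that) (simp add: \<rho>_def)
qed

lemma renaming_inv: "renaming M \<rho> \<Longrightarrow> renaming M (inv \<rho>)"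
  unfolding renaming_def by (metis bij_imp_bij_inv bij_is_surj surj_f_inv_f)

lemma valuation_renaming: "renaming M \<rho> \<Longrightarrow> valuation M v \<Longrightarrow> valuation M (v \<circ> \<rho>)"
  unfolding renaming_def valuation_def by (metis comp_apply)

section \<open>Semantics of existential constraints\<close>

context lc_structure
begin

text \<open>Arguments of theory symbols have theory sorts, so descending from a theory sort through
  theory symbols never leaves the theory sorts.\<close>

lemma theory_term_var_sort:
  "has_sort M t \<tau> \<Longrightarrow> syms t \<subseteq> theory_syms M \<Longrightarrow> \<tau> \<in> theory_sorts M \<Longrightarrow> x \<in> vars t
    \<Longrightarrow> var_sort M x \<in> theory_sorts M"
proof (induction rule: has_sort.induct)
  case (Fun ts f)
  then obtain i where "i < length ts" "x \<in> vars (ts ! i)"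
    by (auto simp: in_set_conv_nth)
  moreover from this have "syms (ts ! i) \<subseteq> theory_syms M" "arg_sorts M f ! i \<in> theory_sorts M"
    using Fun.prems Fun.IH theory_sym_sorts[of f]
    by (force simp: list_all2_conv_all_nth dest: nth_mem)+
  ultimately show ?case
    using Fun.IH Fun.prems by (auto simp: list_all2_conv_all_nth)
qed simp

lemma ex_constraint_var_sort:
  "ex_constraint M (xs, \<phi>) \<Longrightarrow> x \<in> set xs \<union> vars \<phi> \<Longrightarrow> var_sort M x \<in> theory_sorts M"
  using theory_term_var_sort[OF _ _ bool_theory]
  by (auto simp: ex_constraint_def logical_constraint_def)

text \<open>Trades the substituted values for a modified valuation. This works because a value
  symbol denotes itself, which \<open>value_symbol\<close> grants at theory sorts.\<close>

lemma ex_holds_iff: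
  assumes "\<And>x. x \<in> set xs \<Longrightarrow> var_sort M x \<in> theory_sorts M"
  shows "ex_holds M \<rho> (xs, \<phi>) \<longleftrightarrow>
    (\<exists>\<rho>'. (\<forall>x\<in>set xs. \<rho>' x \<in> carrier M (var_sort M x)) \<and> (\<forall>x. x \<notin> set xs \<longrightarrow> \<rho>' x = \<rho> x) \<and>
      holds M \<rho>' \<phi>)" (is "?L \<longleftrightarrow> ?R")
proof
  assume ?L
  then obtain vs where vs: "list_all2 (\<lambda>v x. v \<in> carrier M (var_sort M x)) vs xs"
    and h: "holds M \<rho> (\<phi> \<cdot> list_subst xs vs)"
    by (auto simp: ex_holds_def)
  have len: "length xs = length vs" using vs by (auto dest: list_all2_lengthD)
  define \<rho>' where "\<rho>' = (\<lambda>x. interp_term M \<rho> (list_subst xs vs x))"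
  have "\<rho>' x \<in> carrier M (var_sort M x)" if x: "x \<in> set xs" for x
  proof -
    obtain v where v: "map_of (zip xs vs) x = Some v"
      using x len by (metis map_of_zip_is_Some)
    then have "(x, v) \<in> set (zip xs vs)" by (rule map_of_SomeD)
    then have "v \<in> carrier M (var_sort M x)"
      using vs len by (auto simp: in_set_zip list_all2_conv_all_nth)
    moreover have "var_sort M x \<in> theory_sorts M"
      using assms x by blast
    ultimately show ?thesis
      using v value_symbol by (simp add: \<rho>'_def list_subst_def)
  qed
  moreover have "\<rho>' x = \<rho> x" if "x \<notin> set xs" for x
    using that len by (simp add: \<rho>'_def list_subst_def map_of_zip_is_None[THEN iffD2])
  ultimately show ?R
    using h by (intro exI[of _ \<rho>']) (simp add: holds_def interp_term_subst \<rho>'_def)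
next
  assume ?R
  then obtain \<rho>' where \<rho>': "\<And>x. x \<in> set xs \<Longrightarrow> \<rho>' x \<in> carrier M (var_sort M x)"
    "\<And>x. x \<notin> set xs \<Longrightarrow> \<rho>' x = \<rho> x" "holds M \<rho>' \<phi>" by blast
  \<comment> \<open>The witnesses are read off \<open>\<rho>'\<close>. A variable repeated in
    \<open>xs\<close> receives the same value each time, so the first match taken by
    \<open>map_of\<close> is the right one.\<close>
  have "(\<lambda>x. interp_term M \<rho> (list_subst xs (map \<rho>' xs) x)) = \<rho>'"
  proof
    fix x
    show "interp_term M \<rho> (list_subst xs (map \<rho>' xs) x) = \<rho>' x"
    proof (cases "x \<in> set xs")
      case True
      then show ?thesis
        using value_symbol[OF assms \<rho>'(1)]
        by (simp add: list_subst_def map_of_zip_map)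
    next
      case False
      then show ?thesis using \<rho>'(2) by (simp add: list_subst_def map_of_zip_map)
    qed
  qed
  then have "holds M \<rho> (\<phi> \<cdot> list_subst xs (map \<rho>' xs))"
    using \<rho>'(3) by (simp add: holds_def interp_term_subst)
  moreover have "list_all2 (\<lambda>v x. v \<in> carrier M (var_sort M x)) (map \<rho>' xs) xs"
    using \<rho>'(1) by (simp add: list_all2_conv_all_nth)
  ultimately show ?L by (auto simp: ex_holds_def)
qed

text \<open>The witnesses for the bound variables can be kept, and all other variables of the body
  are free. One direction suffices by symmetry.\<close>

lemma ex_holds_cong:
  assumes "ex_constraint M C" "\<And>x. x \<in> FVar C \<Longrightarrow> \<rho> x = \<rho>' x"
  shows "ex_holds M \<rho> C \<longleftrightarrow> ex_holds M \<rho>' C"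
proof -
  obtain xs \<phi> where C: "C = (xs, \<phi>)" by (cases C)
  have sorts: "\<And>x. x \<in> set xs \<Longrightarrow> var_sort M x \<in> theory_sorts M"
    using assms(1) ex_constraint_var_sort by (auto simp: C)
  have *: "ex_holds M \<beta> C"
    if \<alpha>: "ex_holds M \<alpha> C" "\<And>x. x \<in> FVar C \<Longrightarrow> \<alpha> x = \<beta> x" for \<alpha> \<beta>
  proof -
    obtain \<alpha>' where \<alpha>': "\<And>x. x \<in> set xs \<Longrightarrow> \<alpha>' x \<in> carrier M (var_sort M x)"
      "\<And>x. x \<notin> set xs \<Longrightarrow> \<alpha>' x = \<alpha> x" "holds M \<alpha>' \<phi>"
      using \<alpha>(1) sorts by (auto simp: C ex_holds_iff)
    define \<beta>' where "\<beta>' x = (if x \<in> set xs then \<alpha>' x else \<beta> x)" for x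
    have "interp_term M \<beta>' \<phi> = interp_term M \<alpha>' \<phi>"
      using \<alpha>'(2) \<alpha>(2) by (intro interp_term_cong) (auto simp: \<beta>'_def C FVar_def)
    then show ?thesis
      using \<alpha>' sorts unfolding C
      by (subst ex_holds_iff) (auto simp: \<beta>'_def holds_def intro!: exI[of _ \<beta>'])
  qed
  show ?thesis using *[of \<rho> \<rho>'] *[of \<rho>' \<rho>] assms(2) by metis
qed

text \<open>The substitution lemma for constraints. It holds because \<open>ex_subst\<close> avoids
  capture: changing the values of the bound variables does not affect the terms substituted for free
  ones.\<close>

lemma ex_holds_ex_subst:
  assumes C: "ex_constraint M C"
  shows "ex_holds M \<rho> (ex_subst M C \<sigma>) \<longleftrightarrow> ex_holds M (\<lambda>z. interp_term M \<rho> (\<sigma> z)) C"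
proof -
  obtain xs \<phi> where C_eq: "C = (xs, \<phi>)" by (cases C)
  have sorts: "\<And>x. x \<in> set xs \<Longrightarrow> var_sort M x \<in> theory_sorts M"
    using C ex_constraint_var_sort by (auto simp: C_eq)
  define F where "F = FVar (xs, \<phi>)"
  define R where "R = (\<Union>z\<in>F. vars (\<sigma> z))"
  have vars_\<phi>: "vars \<phi> \<subseteq> F \<union> set xs" by (auto simp: F_def FVar_def)
  \<comment> \<open>Both branches of \<open>ex_subst\<close> get one description, with
    \<open>\<pi> = id\<close> if nothing would be captured.\<close>
  obtain \<pi> where \<pi>: "\<And>x. var_sort M (\<pi> x) = var_sort M x" "inj_on \<pi> (set xs)"
      "\<pi> ` set xs \<inter> R = {}"
    and eq: "ex_subst M C \<sigma> = (map \<pi> xs, \<phi> \<cdot> (\<lambda>z. if z \<in> F then \<sigma> z else Var (\<pi> z)))"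
  proof (cases "set xs \<inter> R = {}")
    case True
    then show thesis
      by (intro that[of id]) (auto simp: C_eq ex_subst_def Let_def F_def R_def subst_restrict_def
          intro!: subst_apply_cong)
  next
    case False
    define \<pi> where "\<pi> = (SOME \<pi>. fresh_renaming M (F \<union> R) (set xs) \<pi>)"
    have "finite (F \<union> R)" by (simp add: F_def R_def FVar_def)
    then have "fresh_renaming M (F \<union> R) (set xs) \<pi>"
      unfolding \<pi>_def using fresh_renaming_exists[of "F \<union> R" "set xs"] sorts
      by (intro someI_ex[of "fresh_renaming M (F \<union> R) (set xs)"]) auto
    then show thesis
      using False by (intro that[of \<pi>])
        (auto simp: fresh_renaming_def C_eq ex_subst_def Let_def simp flip: F_def R_def \<pi>_def)
  qed
  define \<tau> where "\<tau> = (\<lambda>z. if z \<in> F then \<sigma> z else Var (\<pi> z))"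
  have F_xs: "\<And>z. z \<in> F \<Longrightarrow> z \<notin> set xs" by (auto simp: F_def FVar_def)
  \<comment> \<open>Here \<alpha> evaluates the substituted body and \<beta> the original one. On
    free variables they match because \<open>\<sigma> z\<close> avoids the renamed bound variables,
    where alone \<alpha> may differ from \<rho>.\<close>
  have interp_eq: "interp_term M \<alpha> (\<phi> \<cdot> \<tau>) = interp_term M \<beta> \<phi>"
    if \<alpha>: "\<And>x. x \<notin> \<pi> ` set xs \<Longrightarrow> \<alpha> x = \<rho> x"
      and \<beta>: "\<And>x. x \<in> set xs \<Longrightarrow> \<beta> x = \<alpha> (\<pi> x)"
        "\<And>x. x \<notin> set xs \<Longrightarrow> \<beta> x = interp_term M \<rho> (\<sigma> x)" for \<alpha> \<beta>
    unfolding interp_term_subst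
  proof (rule interp_term_cong)
    fix z assume z: "z \<in> vars \<phi>"
    show "interp_term M \<alpha> (\<tau> z) = \<beta> z"
    proof (cases "z \<in> F")
      case True
      then have "interp_term M \<alpha> (\<sigma> z) = interp_term M \<rho> (\<sigma> z)"
        using \<pi>(3) by (intro interp_term_cong \<alpha>) (auto simp: R_def)
      then show ?thesis using True F_xs \<beta>(2)[of z] by (auto simp: \<tau>_def)
    next
      case False
      then show ?thesis using z vars_\<phi> \<beta>(1) by (auto simp: \<tau>_def)
    qed
  qed
  have "ex_holds M \<rho> (map \<pi> xs, \<phi> \<cdot> \<tau>) \<longleftrightarrow> ex_holds M (\<lambda>z. interp_term M \<rho> (\<sigma> z)) (xs, \<phi>)"
    (is "?L \<longleftrightarrow> ?R")
  proof
    assume ?L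
    then obtain \<alpha> where \<alpha>: "\<And>x. x \<in> set xs \<Longrightarrow> \<alpha> (\<pi> x) \<in> carrier M (var_sort M x)"
      "\<And>x. x \<notin> \<pi> ` set xs \<Longrightarrow> \<alpha> x = \<rho> x" "holds M \<alpha> (\<phi> \<cdot> \<tau>)"
      using sorts \<pi>(1) by (subst (asm) ex_holds_iff) auto
    define \<beta> where "\<beta> x = (if x \<in> set xs then \<alpha> (\<pi> x) else interp_term M \<rho> (\<sigma> x))" for x
    have "holds M \<beta> \<phi>" using \<alpha>(3) interp_eq[OF \<alpha>(2), of \<beta>] by (simp add: holds_def \<beta>_def)
    then show ?R
      using \<alpha>(1) sorts by (subst ex_holds_iff) (auto simp: \<beta>_def intro!: exI[of _ \<beta>])
  next
    assume ?R
    then obtain \<beta> where \<beta>: "\<And>x. x \<in> set xs \<Longrightarrow> \<beta> x \<in> carrier M (var_sort M x)"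
      "\<And>x. x \<notin> set xs \<Longrightarrow> \<beta> x = interp_term M \<rho> (\<sigma> x)" "holds M \<beta> \<phi>"
      using sorts by (subst (asm) ex_holds_iff) auto
    \<comment> \<open>The witnesses are carried along \<pi>, which is unambiguous since \<pi> is
      injective on the bound variables.\<close>
    define \<alpha> where
      "\<alpha> x = (if x \<in> \<pi> ` set xs then \<beta> (the_inv_into (set xs) \<pi> x) else \<rho> x)" for x
    have \<alpha>: "\<alpha> (\<pi> x) = \<beta> x" if "x \<in> set xs" for x
      using that the_inv_into_f_f[OF \<pi>(2)] by (auto simp: \<alpha>_def)
    have "holds M \<alpha> (\<phi> \<cdot> \<tau>)"
      using \<beta>(2,3) \<alpha> interp_eq[of \<alpha> \<beta>] by (simp add: holds_def \<alpha>_def)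
    moreover have "\<And>x. x \<notin> \<pi> ` set xs \<Longrightarrow> \<alpha> x = \<rho> x" by (simp add: \<alpha>_def)
    ultimately show ?L
      using \<alpha> \<beta>(1) sorts \<pi>(1) by (subst ex_holds_iff) (auto intro!: exI[of _ \<alpha>])
  qed
  then show ?thesis unfolding eq unfolding C_eq \<tau>_def .
qed

section \<open>Value substitutions and valuations\<close>

text \<open>\<open>valued_on\<close> merely provides a value of some theory sort. Since a value
  symbol has only one sort, sort preservation forces it to be that of \<open>x\<close>.\<close>

lemma valued_on_carrier:
  assumes "substitution M \<sigma>" "valued_on M X \<sigma>" "x \<in> X"
  obtains v where "\<sigma> x = Fun v []" "v \<in> carrier M (var_sort M x)" "v \<in> Val M"
proof -
  obtain \<tau> v where v: "\<sigma> x = Fun v []" "\<tau> \<in> theory_sorts M" "v \<in> carrier M \<tau>"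
    using assms(2,3) by (auto simp: valued_on_def val_terms_def Val_def)
  then have "res_sort M v = \<tau>" using value_symbol by blast
  moreover have "has_sort M (Fun v []) (var_sort M x)"
    using assms(1) v(1) by (metis substitution_def)
  ultimately have "var_sort M x = \<tau>" by (auto elim: has_sort.cases)
  then show thesis using v that by (auto simp: Val_def)
qed

text \<open>Values denote themselves under every valuation, so the truth of the instantiated
  constraint is independent of the valuation quantified in \<open>subst_models\<close>.\<close>

lemma subst_models_iff_ex_holds:
  assumes "ex_constraint M C" "FVar C \<subseteq> X" "var_sort M ` X \<subseteq> theory_sorts M" "valuation M \<rho>"
    and \<sigma>: "\<And>x. x \<in> X \<Longrightarrow> \<sigma> x = Fun (\<rho> x) []"
  shows "subst_models M \<sigma> C \<longleftrightarrow> ex_holds M \<rho> C"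
proof -
  have car: "\<rho> x \<in> carrier M (var_sort M x) \<and> var_sort M x \<in> theory_sorts M" if "x \<in> X" for x
    using assms(3,4) that by (auto simp: valuation_def)
  then have "valued_on M (FVar C) \<sigma>"
    using assms(2) \<sigma> by (fastforce simp: valued_on_def val_terms_def Val_def)
  moreover have "ex_holds M \<alpha> (ex_subst M C \<sigma>) \<longleftrightarrow> ex_holds M \<rho> C" for \<alpha>
    unfolding ex_holds_ex_subst[OF assms(1)]
  proof (rule ex_holds_cong[OF assms(1)])
    fix x assume "x \<in> FVar C"
    then show "interp_term M \<alpha> (\<sigma> x) = \<rho> x"
      using \<sigma>[of x] car[of x] assms(2) value_symbol[of "var_sort M x" "\<rho> x"] by auto
  qed
  \<comment> \<open>The valuation \<rho> itself ensures that the quantifier over valuations is not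
    vacuous.\<close>
  ultimately show ?thesis using assms(4) by (auto simp: subst_models_def)
qed

text \<open>Keeping the variables outside \<open>X\<close> leaves them visible in the instance, so
  that a matching substitution can be read off there.\<close>

definition value_subst :: "'v set \<Rightarrow> ('v \<Rightarrow> 'f) \<Rightarrow> ('f, 'v) subst" where
  "value_subst X \<rho> = (\<lambda>x. if x \<in> X then Fun (\<rho> x) [] else Var x)"

lemma value_subst:
  assumes "var_sort M ` X \<subseteq> theory_sorts M" "valuation M \<rho>"
  shows "substitution M (value_subst X \<rho>)" "valued_on M X (value_subst X \<rho>)"
proof -
  have car: "\<rho> x \<in> carrier M (var_sort M x) \<and> var_sort M x \<in> theory_sorts M" if "x \<in> X" for x
    using assms that by (auto simp: valuation_def)
  then show "valued_on M X (value_subst X \<rho>)"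
    by (fastforce simp: value_subst_def valued_on_def val_terms_def Val_def)
  have "has_sort M (Fun (\<rho> x) []) (var_sort M x)" if "x \<in> X" for x
    using car[OF that] value_symbol[of "var_sort M x" "\<rho> x"] has_sort.Fun[of M "[]" "\<rho> x"] by auto
  then show "substitution M (value_subst X \<rho>)"
    by (auto simp: substitution_def value_subst_def intro: has_sort.Var)
qed

text \<open>A converse to \<open>value_subst\<close>; \<open>w\<close> supplies default values
  outside \<open>X\<close>.\<close>

lemma valuation_of_subst:
  assumes "valuation M w" "substitution M \<sigma>" "valued_on M X \<sigma>"
  obtains \<rho> where "valuation M \<rho>" "\<And>x. x \<in> X \<Longrightarrow> \<sigma> x = Fun (\<rho> x) []"
proof -
  have "\<forall>x. \<exists>v. (x \<in> X \<longrightarrow> \<sigma> x = Fun v [] \<and> v \<in> carrier M (var_sort M x)) \<and> (x \<notin> X \<longrightarrow> v = w x)"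
    by (metis valued_on_carrier[OF assms(2,3)])
  then obtain \<rho> where \<rho>: "\<And>x. x \<in> X \<Longrightarrow> \<sigma> x = Fun (\<rho> x) [] \<and> \<rho> x \<in> carrier M (var_sort M x)"
    "\<And>x. x \<notin> X \<Longrightarrow> \<rho> x = w x"
    by metis
  have "valuation M \<rho>" unfolding valuation_def using \<rho> assms(1) by (metis valuation_def)
  then show thesis using \<rho>(1) that by blast
qed

section \<open>Subsumption along a renaming\<close>

text \<open>The matching substitution is \<open>\<sigma> \<circ> inv \<rho>\<close>. If \<sigma>
  encodes \<open>v\<close> on \<open>X\<close>, it encodes \<open>v \<circ> inv \<rho>\<close> on
  the renamed set, where \<open>imp\<close> yields \<open>D\<close>.\<close>

lemma subsumed_by_if_renaming:
  assumes P: "ex_constrained_term M (X, s, C)"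
    and Q: "ex_constrained_term M (\<rho> ` X, s \<cdot> (Var \<circ> \<rho>), D)"
    and \<rho>: "renaming M \<rho>" and w: "valuation M w"
    and imp: "\<And>v. valuation M v \<Longrightarrow> ex_holds M (v \<circ> \<rho>) C \<Longrightarrow> ex_holds M v D"
  shows "subsumed_by M (X, s, C) (\<rho> ` X, s \<cdot> (Var \<circ> \<rho>), D)"
  unfolding subsumed_by_def prod.case
proof (intro allI impI, elim conjE)
  fix \<sigma> assume \<sigma>: "substitution M \<sigma>" "valued_on M X \<sigma>" "subst_models M \<sigma> C"
  have bij: "bij \<rho>" and inv: "renaming M (inv \<rho>)" using \<rho> renaming_inv by (auto simp: renaming_def)
  then have inv_\<rho>: "inv \<rho> (\<rho> x) = x" "\<rho> (inv \<rho> x) = x" for x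
    by (simp_all add: bij_is_inj bij_is_surj surj_f_inv_f)
  obtain v where v: "valuation M v" "\<And>x. x \<in> X \<Longrightarrow> \<sigma> x = Fun (v x) []"
    using valuation_of_subst[OF w \<sigma>(1,2)] by blast
  have "ex_holds M v C"
    using \<sigma>(3) P subst_models_iff_ex_holds[OF _ _ _ v(1), of C X \<sigma>] v(2)
    by (auto simp: ex_constrained_term_def)
  moreover have "v \<circ> inv \<rho> \<circ> \<rho> = v" by (auto simp: inv_\<rho>)
  ultimately have D: "ex_holds M (v \<circ> inv \<rho>) D"
    using imp[of "v \<circ> inv \<rho>"] valuation_renaming[OF inv v(1)] by simp
  define \<gamma> where "\<gamma> = \<sigma> \<circ> inv \<rho>"
  have "substitution M \<gamma>"
    using \<sigma>(1) inv by (metis \<gamma>_def comp_apply renaming_def substitution_def)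
  moreover have "valued_on M (\<rho> ` X) \<gamma>"
    using \<sigma>(2) by (auto simp: valued_on_def \<gamma>_def inv_\<rho>)
  moreover have "\<gamma> y = Fun ((v \<circ> inv \<rho>) y) []" if "y \<in> \<rho> ` X" for y
    using that v(2) by (auto simp: \<gamma>_def inv_\<rho>)
  then have "subst_models M \<gamma> D"
    using Q D subst_models_iff_ex_holds[OF _ _ _ valuation_renaming[OF inv v(1)], of D "\<rho> ` X" \<gamma>]
    by (auto simp: ex_constrained_term_def)
  moreover have "s \<cdot> \<sigma> = s \<cdot> (Var \<circ> \<rho>) \<cdot> \<gamma>"
    unfolding subst_renaming_apply by (rule subst_apply_cong) (simp add: \<gamma>_def inv_\<rho>)
  ultimately show "\<exists>\<gamma>. substitution M \<gamma> \<and> valued_on M (\<rho> ` X) \<gamma> \<and> subst_models M \<gamma> D \<and>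
      s \<cdot> \<sigma> = s \<cdot> (Var \<circ> \<rho>) \<cdot> \<gamma>" by blast
qed

text \<open>Instantiate \<open>X\<close> by the values of \<open>v \<circ> \<rho>\<close>. Every
  variable of \<open>X\<close> occurs in \<open>s\<close>, so equality of the instances forces
  \<gamma> to encode \<open>v\<close> on the renamed set, and \<open>D\<close> holds under
  \<open>v\<close>.\<close>

lemma renaming_implies_if_subsumed_by:
  assumes P: "ex_constrained_term M (X, s, C)"
    and Q: "ex_constrained_term M (\<rho> ` X, s \<cdot> (Var \<circ> \<rho>), D)"
    and \<rho>: "renaming M \<rho>" and sub: "subsumed_by M (X, s, C) (\<rho> ` X, s \<cdot> (Var \<circ> \<rho>), D)"
    and v: "valuation M v" "ex_holds M (v \<circ> \<rho>) C"
  shows "ex_holds M v D"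
proof -
  have X: "var_sort M ` X \<subseteq> theory_sorts M" "X \<subseteq> vars s" "ex_constraint M C" "FVar C \<subseteq> X"
    using P by (auto simp: ex_constrained_term_def)
  have v\<rho>: "valuation M (v \<circ> \<rho>)" using \<rho> v(1) by (rule valuation_renaming)
  have "subst_models M (value_subst X (v \<circ> \<rho>)) C"
    using subst_models_iff_ex_holds[OF X(3,4,1) v\<rho>] v(2) by (simp add: value_subst_def)
  then obtain \<gamma> where \<gamma>: "subst_models M \<gamma> D" "s \<cdot> value_subst X (v \<circ> \<rho>) = s \<cdot> (Var \<circ> \<rho>) \<cdot> \<gamma>"
    using sub value_subst[OF X(1) v\<rho>] unfolding subsumed_by_def by blast
  from \<gamma>(2) have "\<gamma> (\<rho> x) = Fun (v (\<rho> x)) []" if "x \<in> X" for x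
    using that X(2) unfolding subst_renaming_apply subst_apply_eq_iff
    by (force simp: value_subst_def)
  then show ?thesis
    using subst_models_iff_ex_holds[OF _ _ _ v(1), of D "\<rho> ` X" \<gamma>] Q \<gamma>(1)
    by (auto simp: ex_constrained_term_def)
qed

end

section \<open>Extracting a renaming from equivalence\<close>

text \<open>\<open>V\<close> stands for the values. If a variable faced a function symbol, then
  \<open>\<sigma>\<^sub>0\<close> or \<open>\<gamma>\<^sub>0\<close> would map that variable to a
  term headed by this symbol, making the symbol a value inside \<open>s\<close> or
  \<open>t\<close>.\<close>

lemma rel_trm_if_instances:
  assumes "s \<cdot> \<sigma>\<^sub>0 = t \<cdot> \<gamma>" "t \<cdot> \<gamma>\<^sub>0 = s \<cdot> \<sigma>"
    and "syms s \<inter> V = {}" "syms t \<inter> V = {}"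
    and "\<And>x f us. \<sigma>\<^sub>0 x = Fun f us \<Longrightarrow> f \<in> V" "\<And>y f us. \<gamma>\<^sub>0 y = Fun f us \<Longrightarrow> f \<in> V"
  shows "rel_trm (=) (\<lambda>x y. \<sigma>\<^sub>0 x = \<gamma> y \<and> \<gamma>\<^sub>0 y = \<sigma> x) s t"
  using assms(1-4)
proof (induction s arbitrary: t)
  case (Var x)
  then show ?case using assms(5)[of x] by (cases t) auto
next
  case (Fun f ss)
  show ?case
  proof (cases t)
    case (Var y)
    then show ?thesis using Fun.prems assms(6)[of y] by auto
  next
    case t: (Fun g ts)
    have eqs: "map (\<lambda>s. s \<cdot> \<sigma>\<^sub>0) ss = map (\<lambda>t. t \<cdot> \<gamma>) ts" "map (\<lambda>t. t \<cdot> \<gamma>\<^sub>0) ts = map (\<lambda>s. s \<cdot> \<sigma>) ss"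
      using Fun.prems(1,2) by (auto simp: t)
    have "list_all2 (rel_trm (=) (\<lambda>x y. \<sigma>\<^sub>0 x = \<gamma> y \<and> \<gamma>\<^sub>0 y = \<sigma> x)) ss ts"
      unfolding list_all2_conv_all_nth
    proof (intro conjI allI impI)
      show len: "length ss = length ts" using eqs(1) by (metis length_map)
      fix i assume i: "i < length ss"
      then have "ss ! i \<in> set ss" "ts ! i \<in> set ts" using len by auto
      moreover have "ss ! i \<cdot> \<sigma>\<^sub>0 = ts ! i \<cdot> \<gamma>" "ts ! i \<cdot> \<gamma>\<^sub>0 = ss ! i \<cdot> \<sigma>"
        using eqs i len by (metis nth_map)+
      ultimately show "rel_trm (=) (\<lambda>x y. \<sigma>\<^sub>0 x = \<gamma> y \<and> \<gamma>\<^sub>0 y = \<sigma> x) (ss ! i) (ts ! i)"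
        using Fun.prems(3,4) by (intro Fun.IH) (auto simp: t)
    qed
    then show ?thesis using Fun.prems(1) by (simp add: t)
  qed
qed

text \<open>The form in which linearity is used: \<open>zs\<close> will list pairs of facing
  variables, and \<open>f\<close> will be \<open>fst\<close> or \<open>snd\<close>.\<close>

lemma count_list_map_le_1D:
  assumes "count_list (map f zs) x \<le> 1" "p \<in> set zs" "q \<in> set zs" "f p = x" "f q = x"
  shows "p = q"
proof -
  \<comment> \<open>Splitting at \<open>p\<close> uses up the one permitted occurrence of
    \<open>x\<close>, so \<open>q\<close> can only be \<open>p\<close>.\<close>
  obtain as bs where zs: "zs = as @ p # bs" using assms(2) by (meson split_list)
  then have "x \<notin> f ` (set as \<union> set bs)"
    using assms(1,4) by (auto simp: count_list_0_iff)
  then show ?thesis using assms(3,5) zs by auto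
qed

context lc_structure
begin

lemma renaming_if_equivalent:
  assumes P: "ex_constrained_term M (X, s, C)" and Q: "ex_constrained_term M (Y, t, D)"
    and sat: "satisfiable M (X, s, C)" "satisfiable M (Y, t, D)"
    and gen: "pattern_general M (X, s, C)" "pattern_general M (Y, t, D)"
    and equ: "equivalent M (X, s, C) (Y, t, D)"
  obtains \<rho> where "renaming M \<rho>" "s \<cdot> (Var \<circ> \<rho>) = t" "\<rho> ` X = Y"
proof -
  have X: "var_sort M ` X \<subseteq> theory_sorts M" "X \<subseteq> vars s" "ex_constraint M C" "FVar C \<subseteq> X"
    using P by (auto simp: ex_constrained_term_def)
  have Y: "var_sort M ` Y \<subseteq> theory_sorts M" "Y \<subseteq> vars t" "ex_constraint M D" "FVar D \<subseteq> Y"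
    using Q by (auto simp: ex_constrained_term_def)
  obtain v w where v: "valuation M v" "ex_holds M v C" and w: "valuation M w" "ex_holds M w D"
    using sat by (auto simp: satisfiable_def ex_satisfiable_def)
  define \<sigma>\<^sub>0 \<gamma>\<^sub>0 where "\<sigma>\<^sub>0 = value_subst X v" and "\<gamma>\<^sub>0 = value_subst Y w"
  have \<sigma>\<^sub>0: "substitution M \<sigma>\<^sub>0" "valued_on M X \<sigma>\<^sub>0"
    and \<gamma>\<^sub>0: "substitution M \<gamma>\<^sub>0" "valued_on M Y \<gamma>\<^sub>0"
    using value_subst X(1) Y(1) v(1) w(1) by (auto simp: \<sigma>\<^sub>0_def \<gamma>\<^sub>0_def)
  have "subst_models M \<sigma>\<^sub>0 C" "subst_models M \<gamma>\<^sub>0 D"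
    using subst_models_iff_ex_holds[OF X(3,4,1) v(1)] subst_models_iff_ex_holds[OF Y(3,4,1) w(1)] v w
    by (auto simp: \<sigma>\<^sub>0_def \<gamma>\<^sub>0_def value_subst_def)
  then obtain \<gamma> \<sigma> where \<gamma>: "substitution M \<gamma>" "valued_on M Y \<gamma>" "s \<cdot> \<sigma>\<^sub>0 = t \<cdot> \<gamma>"
    and \<sigma>: "substitution M \<sigma>" "valued_on M X \<sigma>" "t \<cdot> \<gamma>\<^sub>0 = s \<cdot> \<sigma>"
    using equ \<sigma>\<^sub>0 \<gamma>\<^sub>0 unfolding equivalent_def subsumed_by_def prod.case by meson
  have outside: "x \<notin> X \<Longrightarrow> \<sigma>\<^sub>0 x = Var x" "x \<notin> Y \<Longrightarrow> \<gamma>\<^sub>0 x = Var x" for x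
    by (auto simp: \<sigma>\<^sub>0_def \<gamma>\<^sub>0_def value_subst_def)
  have vals: "f \<in> Val M" if "\<sigma>\<^sub>0 x = Fun f us \<or> \<gamma>\<^sub>0 x = Fun f us" for x f us
    using that outside valued_on_carrier[OF \<sigma>\<^sub>0] valued_on_carrier[OF \<gamma>\<^sub>0]
    by (metis trm.distinct(1) trm.inject(2))
  define R where "R x y \<longleftrightarrow> \<sigma>\<^sub>0 x = \<gamma> y \<and> \<gamma>\<^sub>0 y = \<sigma> x" for x y
  have "rel_trm (=) R s t"
    unfolding R_def
    using \<gamma>(3) \<sigma>(3) gen vals
    by (intro rel_trm_if_instances[where V = "Val M"]) (auto simp: pattern_general_def)
  \<comment> \<open>\<open>z\<close> is a term over pairs that projects to \<open>s\<close> and to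
    \<open>t\<close>; its variables are exactly the pairs of facing variables.\<close>
  then obtain z where z: "\<And>p. p \<in> syms z \<Longrightarrow> fst p = snd p" "\<And>p. p \<in> vars z \<Longrightarrow> R (fst p) (snd p)"
      and s: "s = map_trm fst fst z" and t: "t = map_trm snd snd z"
    unfolding trm.in_rel by fastforce
  have not_Var: "\<sigma> x \<noteq> Var y" "\<sigma>\<^sub>0 x \<noteq> Var y" if "x \<in> X" for x y
    using valued_on_carrier[OF \<sigma>(1,2) that] valued_on_carrier[OF \<sigma>\<^sub>0 that] by (metis trm.distinct(1))+
  have not_Var': "\<gamma> x \<noteq> Var y" "\<gamma>\<^sub>0 x \<noteq> Var y" if "x \<in> Y" for x y
    using valued_on_carrier[OF \<gamma>(1,2) that] valued_on_carrier[OF \<gamma>\<^sub>0 that] by (metis trm.distinct(1))+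
  \<comment> \<open>If \<open>x\<close> is in \<open>X\<close>, then
    \<open>\<sigma> x = \<gamma>\<^sub>0 y\<close> is a value, whereas
    \<open>\<gamma>\<^sub>0\<close> fixes variables outside \<open>Y\<close>. The converse uses
    \<open>\<gamma> y = \<sigma>\<^sub>0 x\<close> in the same way.\<close>
  have XY: "x \<in> X \<longleftrightarrow> y \<in> Y" if "R x y" for x y
    using that not_Var not_Var' outside unfolding R_def by metis
  \<comment> \<open>The single term \<open>\<sigma>\<^sub>0 x = \<gamma> y\<close> has the sort of
    \<open>x\<close> as well as that of \<open>y\<close>.\<close>
  have sorts: "var_sort M y = var_sort M x" if "R x y" for x y
    using that \<sigma>\<^sub>0(1) \<gamma>(1) has_sort_unique unfolding R_def substitution_def by metis
  have vars_s: "vars s = fst ` vars z" and vars_t: "vars t = snd ` vars z"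
    by (simp_all add: s t trm.set_map)
  have lin: "count_list (map fst (vars_list z)) x \<le> 1" if "x \<in> X" for x
    using gen(1) that by (auto simp: pattern_general_def s vars_list_map_trm)
  have lin': "count_list (map snd (vars_list z)) y \<le> 1" if "y \<in> Y" for y
    using gen(2) that by (auto simp: pattern_general_def t vars_list_map_trm)
  \<comment> \<open>On \<open>X\<close> the partner is unique because the variable occurs once;
    elsewhere \<sigma> maps the variable to its partner. \<open>snd_eqD\<close> is the mirror image
    with \<gamma>.\<close>
  have fst_eqD: "p = q" if pq: "p \<in> vars z" "q \<in> vars z" "fst p = fst q" for p q
  proof (cases "fst p \<in> X")
    case True
    show ?thesis by (rule count_list_map_le_1D[OF lin[OF True]]) (use pq in auto)
  next
    case False
    then have "snd p \<notin> Y" "snd q \<notin> Y" using XY z(2) pq by metis+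
    then have "Var (snd p) = \<sigma> (fst p)" "Var (snd q) = \<sigma> (fst q)"
      using z(2)[OF pq(1)] z(2)[OF pq(2)] outside(2) by (auto simp: R_def)
    then show ?thesis using pq(3) by (metis prod_eq_iff trm.inject(1))
  qed
  have snd_eqD: "p = q" if pq: "p \<in> vars z" "q \<in> vars z" "snd p = snd q" for p q
  proof (cases "snd p \<in> Y")
    case True
    show ?thesis by (rule count_list_map_le_1D[OF lin'[OF True]]) (use pq in auto)
  next
    case False
    then have "fst p \<notin> X" "fst q \<notin> X" using XY z(2) pq by metis+
    then have "Var (fst p) = \<gamma> (snd p)" "Var (fst q) = \<gamma> (snd q)"
      using z(2)[OF pq(1)] z(2)[OF pq(2)] outside(1) by (auto simp: R_def)
    then show ?thesis using pq(3) by (metis prod_eq_iff trm.inject(1))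
  qed
  have fst_inj: "inj_on fst (vars z)" by (rule inj_onI) (rule fst_eqD)
  \<comment> \<open>\<open>f\<close> sends a variable of \<open>s\<close> to its partner in
    \<open>t\<close>; \<open>fst_eqD\<close> makes it well defined and \<open>snd_eqD\<close>
    injective.\<close>
  define f where "f x = snd (the_inv_into (vars z) fst x)" for x
  have f: "f (fst p) = snd p" if "p \<in> vars z" for p
    using the_inv_into_f_f[OF fst_inj that] by (simp add: f_def)
  have "inj_on f (vars s)"
  proof (rule inj_onI)
    fix x y assume "x \<in> vars s" "y \<in> vars s" "f x = f y"
    then obtain p q where "p \<in> vars z" "q \<in> vars z" "x = fst p" "y = fst q" "snd p = snd q"
      using f vars_s by auto
    then show "x = y" using snd_eqD by blast
  qed
  moreover have "var_sort M (f x) = var_sort M x" if "x \<in> vars s" for x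
    using that f sorts z(2) unfolding vars_s by auto
  ultimately obtain \<rho> where \<rho>: "renaming M \<rho>" "\<And>x. x \<in> vars s \<Longrightarrow> \<rho> x = f x"
    using extend_to_renaming[of "vars s" f M] by auto
  have \<rho>_z: "\<rho> (fst p) = snd p" if "p \<in> vars z" for p
    using that \<rho>(2) f by (simp add: vars_s)
  \<comment> \<open>Symbol pairs in \<open>z\<close> are diagonal, so renaming the variables already
    turns the first projection into the second.\<close>
  have "s \<cdot> (Var \<circ> \<rho>) = t"
    unfolding subst_Var_comp s t trm.map_comp
    by (rule trm.map_cong0) (use z(1) \<rho>_z in auto)
  moreover have "\<rho> ` X = Y"
  proof (intro equalityI subsetI)
    fix y assume "y \<in> \<rho> ` X"
    then obtain p where "p \<in> vars z" "fst p \<in> X" "y = \<rho> (fst p)"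
      using X(2) vars_s by auto
    then show "y \<in> Y" using XY z(2) \<rho>_z by metis
  next
    fix y assume "y \<in> Y"
    then obtain p where "p \<in> vars z" "y = snd p" using Y(2) vars_t by auto
    then show "y \<in> \<rho> ` X" using XY z(2) \<rho>_z \<open>y \<in> Y\<close> by (metis imageI)
  qed
  ultimately show thesis using \<rho>(1) that by blast
qed

section \<open>Equivalence along a fixed renaming, and the characterization\<close>

text \<open>Each subsumption amounts to one implication between the constraints. The backward one is
  obtained from the forward case applied to \<open>inv \<rho>\<close>, which carries the renamed
  term back to \<open>s\<close>.\<close>

lemma equivalent_renaming_iff:
  assumes P: "ex_constrained_term M (X, s, C)"
    and Q: "ex_constrained_term M (\<rho> ` X, s \<cdot> (Var \<circ> \<rho>), D)"
    and \<rho>: "renaming M \<rho>" and w: "valuation M w"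
  shows "equivalent M (X, s, C) (\<rho> ` X, s \<cdot> (Var \<circ> \<rho>), D) \<longleftrightarrow>
    ex_equiv M (ex_subst M C (Var \<circ> \<rho>)) D"
proof -
  let ?t = "s \<cdot> (Var \<circ> \<rho>)"
  have bij: "bij \<rho>" and inv: "renaming M (inv \<rho>)" using \<rho> renaming_inv by (auto simp: renaming_def)
  have inv_\<rho>: "inv \<rho> \<circ> \<rho> = id" "\<rho> \<circ> inv \<rho> = id"
    using bij by (auto simp: bij_is_inj bij_is_surj surj_iff[symmetric])
  have X: "inv \<rho> ` \<rho> ` X = X" using bij by (simp add: bij_is_inj)
  have s: "?t \<cdot> (Var \<circ> inv \<rho>) = s"
    by (simp add: subst_Var_comp trm.map_comp inv_\<rho> trm.map_id0)
  have "subsumed_by M (X, s, C) (\<rho> ` X, ?t, D) \<longleftrightarrow>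
      (\<forall>v. valuation M v \<longrightarrow> ex_holds M (v \<circ> \<rho>) C \<longrightarrow> ex_holds M v D)"
    using subsumed_by_if_renaming[OF P Q \<rho> w] renaming_implies_if_subsumed_by[OF P Q \<rho>] by blast
  moreover have "subsumed_by M (\<rho> ` X, ?t, D) (X, s, C) \<longleftrightarrow>
      (\<forall>v. valuation M v \<longrightarrow> ex_holds M (v \<circ> inv \<rho>) D \<longrightarrow> ex_holds M v C)"
    using subsumed_by_if_renaming[OF Q _ inv w, of C]
      renaming_implies_if_subsumed_by[OF Q _ inv, of C] P
    unfolding X s by blast
  \<comment> \<open>A change of variables: \<open>v \<mapsto> v \<circ> \<rho>\<close> permutes the
    valuations, with inverse given by \<open>inv \<rho>\<close>.\<close>
  moreover have "(\<forall>v. valuation M v \<longrightarrow> ex_holds M (v \<circ> inv \<rho>) D \<longrightarrow> ex_holds M v C) \<longleftrightarrow>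
      (\<forall>v. valuation M v \<longrightarrow> ex_holds M v D \<longrightarrow> ex_holds M (v \<circ> \<rho>) C)"
    (is "?A \<longleftrightarrow> ?B")
  proof
    assume A: ?A
    show ?B
    proof (intro allI impI)
      fix v assume "valuation M v" "ex_holds M v D"
      then show "ex_holds M (v \<circ> \<rho>) C"
        using A[rule_format, of "v \<circ> \<rho>"] valuation_renaming[OF \<rho>] by (simp add: comp_assoc inv_\<rho>)
    qed
  next
    assume B: ?B
    show ?A
    proof (intro allI impI)
      fix v assume "valuation M v" "ex_holds M (v \<circ> inv \<rho>) D"
      then show "ex_holds M v C"
        using B[rule_format, of "v \<circ> inv \<rho>"] valuation_renaming[OF inv] by (simp add: comp_assoc inv_\<rho>)
    qed
  qed
  moreover have "ex_holds M v (ex_subst M C (Var \<circ> \<rho>)) \<longleftrightarrow> ex_holds M (v \<circ> \<rho>) C" for v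
    using P ex_holds_ex_subst[of C v "Var \<circ> \<rho>"] by (auto simp: ex_constrained_term_def comp_def)
  ultimately show ?thesis
    unfolding equivalent_def ex_equiv_def by blast
qed

end

theorem theorem3:
  fixes M :: "('s, 'f, 'v) lc_model"
    and X Y :: "'v set" and s t :: "('f, 'v) trm"
    and xs ys :: "'v list" and \<phi> \<psi> :: "('f, 'v) trm"
  assumes "lc_structure M"
    and "ex_constrained_term M (X, s, (xs, \<phi>))"
    and "ex_constrained_term M (Y, t, (ys, \<psi>))"
    and "satisfiable M (X, s, (xs, \<phi>))"
    and "satisfiable M (Y, t, (ys, \<psi>))"
    and "pattern_general M (X, s, (xs, \<phi>))"
    and "pattern_general M (Y, t, (ys, \<psi>))"
  shows "equivalent M (X, s, (xs, \<phi>)) (Y, t, (ys, \<psi>)) \<longleftrightarrow>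
    (\<exists>\<rho>. renaming M \<rho> \<and> s \<cdot> (Var \<circ> \<rho>) = t \<and> \<rho> ` X = Y \<and>
      ex_equiv M (ex_subst M (xs, \<phi>) (Var \<circ> \<rho>)) (ys, \<psi>))"
proof -
  interpret lc_structure M by fact
  obtain w where w: "valuation M w"
    using assms(4) by (auto simp: satisfiable_def ex_satisfiable_def)
  \<comment> \<open>For any renaming that matches the terms and the variable sets, equivalence and
    the constraint condition coincide. What remains is the existence of such a renaming, which
    equivalence provides.\<close>
  have "equivalent M (X, s, (xs, \<phi>)) (Y, t, (ys, \<psi>)) \<longleftrightarrow>
      ex_equiv M (ex_subst M (xs, \<phi>) (Var \<circ> \<rho>)) (ys, \<psi>)"
    if "renaming M \<rho>" "s \<cdot> (Var \<circ> \<rho>) = t" "\<rho> ` X = Y" for \<rho>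
    using equivalent_renaming_iff[OF assms(2) _ that(1) w, of "(ys, \<psi>)"] assms(3) that(2,3) by simp
  then show ?thesis
    using renaming_if_equivalent[OF assms(2-7)] by metis
qed

end
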